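(* Let $\mathcal{G}$ be a nonempty groupoid and $\mathcal{Z}(\mathcal{G})$ the center of $\mathcal{G}$. Then: 1. $\mathcal{Z}(\mathcal{G})=\bigsqcup_{e\in\mathcal{G}_0}Z(\mathcal{G}_e)$, where $Z(\mathcal{G}_e)$ is the center of the group $\mathcal{G}_e$. 2. $\mathcal{Z}(\mathcal{G})=\mathrm{Iso}(\mathcal{G})$ if and only if $\mathcal{G}$ is an abelian groupoid. 3. $\mathcal{Z}(\mathcal{G})$ is a normal subgroupoid of $\mathrm{Iso}(\mathcal{G})$. 4. If $\mathcal{H}$ is a wide subgroupoid of $\mathcal{Z}(\mathcal{G})$, then $\mathcal{H}$ is normal in $\mathrm{Iso}(\mathcal{G})$.
   Context: Groupoids are taken in the algebraic sense. Let $\mathcal{G}$ be a set with a partial binary operation written as concatenation; $\exists gh$ means that the product $gh$ is defined. An element $e\in\mathcal{G}$ is an identity if $\exists eg$ implies $eg=g$ and $\exists g'e$ implies $g'e=g'$; $\mathcal{G}_0$ is the set of identities. $\mathcal{G}$ is a groupoid if: (1) $\exists g(hl)$ iff $\exists (gh)l$, and then $g(hl)=(gh)l$; (2) $\exists g(hl)$ iff $\exists gh$ and $\exists hl$; (3) for each $g$ there are unique $d(g),r(g)\in\mathcal{G}$ with $\exists g\,d(g)$, $\exists r(g)\,g$ and $g\,d(g)=g=r(g)\,g$; (4) for each $g$ there is $g^{-1}\in\mathcal{G}$ with $d(g)=g^{-1}g$ and $r(g)=gg^{-1}$. (Equivalently, $\mathcal{G}$ is the set of morphisms of a small category in which every morphism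 is invertible; $\exists gh$ iff $d(g)=r(h)$, and $\mathcal{G}_0=\{d(g)\mid g\in\mathcal{G}\}$.) For $e\in\mathcal{G}_0$, $\mathcal{G}_e=\{g\in\mathcal{G}\mid d(g)=r(g)=e\}$ is the isotropy group at $e$ (a group with identity $e$), and $\mathrm{Iso}(\mathcal{G})=\bigcup_{e\in\mathcal{G}_0}\mathcal{G}_e$. $\mathcal{G}$ is abelian if all its isotropy groups $\mathcal{G}_e$ are abelian. A nonempty subset $\mathcal{H}\subseteq\mathcal{G}$ is a subgroupoid of $\mathcal{G}$ if for all $g,h\in\mathcal{H}$: $g^{-1}\in\mathcal{H}$, and $\exists gh$ implies $gh\in\mathcal{H}$. It is wide if $\mathcal{H}_0=\mathcal{G}_0$, equivalently $\mathcal{G}_0\subseteq\mathcal{H}$. A subgroupoid is itself a groupoid under the restricted operation. For a wide subgroupoid $\mathcal{H}$ and $g\in\mathcal{G}$, $g^{-1}\mathcal{H}g=\{g^{-1}hg\mid h\in\mathcal{H},\ r(h)=d(h)=r(g)\}$. A subgroupoid $\mathcal{H}$ of $\mathcal{G}$ is normal if it is wide and $g^{-1}\mathcal{H}g\subseteq\mathcal{H}$ for all $g\in\mathcal{G}$. The center of $\mathcal{G}$ is $\mathcal{Z}(\mathcal{G})=\{g\in\mathrm{Iso}(\mathcal{G})\mid gh=hg\text{ for all }h\in\mathcal{G}\text{ such that }d(g)=r(h)=d(h)\}$. *)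

theory Defs
  imports "HOL-Algebra.Group" "HOL-Library.Disjoint_Sets"
begin

text \<open>A set with a partial binary operation: \<open>g \<cdot> h = None\<close> means that the product is not
  defined, and \<open>g \<cdot> h = Some k\<close> that it is defined and equal to \<open>k\<close>. Only the values
  on the carrier matter.\<close>

record 'a partial_magma = "'a partial_object" +
  pmult :: "'a \<Rightarrow> 'a \<Rightarrow> 'a option" (infixl \<open>\<cdot>\<index>\<close> 70)

definition identities :: "('a, 'b) partial_magma_scheme \<Rightarrow> 'a set" where
  "identities G = {e \<in> carrier G.
     (\<forall>g \<in> carrier G. e \<cdot>\<^bsub>G\<^esub> g \<noteq> None \<longrightarrow> e \<cdot>\<^bsub>G\<^esub> g = Some g) \<and>
     (\<forall>g \<in> carrier G. g \<cdot>\<^bsub>G\<^esub> e \<noteq> None \<longrightarrow> g \<cdot>\<^bsub>G\<^esub> e = Some g)}"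

definition dom_id :: "('a, 'b) partial_magma_scheme \<Rightarrow> 'a \<Rightarrow> 'a" where
  "dom_id G g = (THE d. d \<in> carrier G \<and> g \<cdot>\<^bsub>G\<^esub> d = Some g)"

definition ran_id :: "('a, 'b) partial_magma_scheme \<Rightarrow> 'a \<Rightarrow> 'a" where
  "ran_id G g = (THE r. r \<in> carrier G \<and> r \<cdot>\<^bsub>G\<^esub> g = Some g)"

definition g_inv :: "('a, 'b) partial_magma_scheme \<Rightarrow> 'a \<Rightarrow> 'a" where
  "g_inv G g = (THE g'. g' \<in> carrier G \<and>
     g' \<cdot>\<^bsub>G\<^esub> g = Some (dom_id G g) \<and> g \<cdot>\<^bsub>G\<^esub> g' = Some (ran_id G g))"

text \<open>With \<open>Option.bind\<close>, \<open>g(hl)\<close> is \<open>Option.bind (h \<cdot> l) (\<lambda>x. g \<cdot> x)\<close> and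
  \<open>(gh)l\<close> is \<open>Option.bind (g \<cdot> h) (\<lambda>x. x \<cdot> l)\<close>. Equality of the two options says that one
  product is defined iff the other is, and that they then agree.\<close>

locale groupoid =
  fixes G (structure)
  assumes closed:
      "\<And>g h k. \<lbrakk>g \<in> carrier G; h \<in> carrier G; g \<cdot> h = Some k\<rbrakk> \<Longrightarrow> k \<in> carrier G"
    and assoc:
      "\<And>g h l. \<lbrakk>g \<in> carrier G; h \<in> carrier G; l \<in> carrier G\<rbrakk> \<Longrightarrow>
        Option.bind (h \<cdot> l) (\<lambda>x. g \<cdot> x) = Option.bind (g \<cdot> h) (\<lambda>x. x \<cdot> l)"
    and defined_iff:
      "\<And>g h l. \<lbrakk>g \<in> carrier G; h \<in> carrier G; l \<in> carrier G\<rbrakk> \<Longrightarrow>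
        Option.bind (h \<cdot> l) (\<lambda>x. g \<cdot> x) \<noteq> None \<longleftrightarrow> g \<cdot> h \<noteq> None \<and> h \<cdot> l \<noteq> None"
    and ex1_dom: "\<And>g. g \<in> carrier G \<Longrightarrow> \<exists>!d. d \<in> carrier G \<and> g \<cdot> d = Some g"
    and ex1_ran: "\<And>g. g \<in> carrier G \<Longrightarrow> \<exists>!r. r \<in> carrier G \<and> r \<cdot> g = Some g"
    and ex_inv:
      "\<And>g. g \<in> carrier G \<Longrightarrow>
        \<exists>g' \<in> carrier G. g' \<cdot> g = Some (dom_id G g) \<and> g \<cdot> g' = Some (ran_id G g)"

definition isotropy :: "('a, 'b) partial_magma_scheme \<Rightarrow> 'a \<Rightarrow> 'a set" where
  "isotropy G e = {g \<in> carrier G. dom_id G g = e \<and> ran_id G g = e}"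

text \<open>The product of two elements of \<open>isotropy G e\<close> is always defined, so \<open>the\<close> is harmless.\<close>

definition isotropy_group :: "('a, 'b) partial_magma_scheme \<Rightarrow> 'a \<Rightarrow> 'a monoid" where
  "isotropy_group G e =
     \<lparr>carrier = isotropy G e, mult = (\<lambda>g h. the (g \<cdot>\<^bsub>G\<^esub> h)), one = e\<rparr>"

definition Iso :: "('a, 'b) partial_magma_scheme \<Rightarrow> 'a set" where
  "Iso G = (\<Union>e \<in> identities G. isotropy G e)"

definition abelian_groupoid :: "('a, 'b) partial_magma_scheme \<Rightarrow> bool" where
  "abelian_groupoid G \<longleftrightarrow>
     groupoid G \<and> (\<forall>e \<in> identities G. comm_group (isotropy_group G e))"

definition group_center :: "('a, 'b) monoid_scheme \<Rightarrow> 'a set" where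
  "group_center M = {z \<in> carrier M. \<forall>x \<in> carrier M. z \<otimes>\<^bsub>M\<^esub> x = x \<otimes>\<^bsub>M\<^esub> z}"

definition groupoid_center :: "('a, 'b) partial_magma_scheme \<Rightarrow> 'a set" where
  "groupoid_center G = {g \<in> Iso G. \<forall>h \<in> carrier G.
     dom_id G g = ran_id G h \<and> ran_id G h = dom_id G h \<longrightarrow> g \<cdot>\<^bsub>G\<^esub> h = h \<cdot>\<^bsub>G\<^esub> g}"

text \<open>A subset with the restricted operation.\<close>

abbreviation restrict_to ::
    "('a, 'b) partial_magma_scheme \<Rightarrow> 'a set \<Rightarrow> ('a, 'b) partial_magma_scheme" where
  "restrict_to G H \<equiv> G\<lparr>carrier := H\<rparr>"

definition subgroupoid :: "'a set \<Rightarrow> ('a, 'b) partial_magma_scheme \<Rightarrow> bool" where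
  "subgroupoid H G \<longleftrightarrow> H \<subseteq> carrier G \<and> H \<noteq> {} \<and>
     (\<forall>g \<in> H. g_inv G g \<in> H) \<and>
     (\<forall>g \<in> H. \<forall>h \<in> H. \<forall>k. g \<cdot>\<^bsub>G\<^esub> h = Some k \<longrightarrow> k \<in> H)"

definition wide_subgroupoid :: "'a set \<Rightarrow> ('a, 'b) partial_magma_scheme \<Rightarrow> bool" where
  "wide_subgroupoid H G \<longleftrightarrow>
     subgroupoid H G \<and> identities (restrict_to G H) = identities G"

definition conj_set :: "('a, 'b) partial_magma_scheme \<Rightarrow> 'a \<Rightarrow> 'a set \<Rightarrow> 'a set" where
  "conj_set G g H = {x. \<exists>h \<in> H. ran_id G h = dom_id G h \<and> dom_id G h = ran_id G g \<and>
     Option.bind (g_inv G g \<cdot>\<^bsub>G\<^esub> h) (\<lambda>y. y \<cdot>\<^bsub>G\<^esub> g) = Some x}"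

text \<open>As for \<open>normal\<close> in HOL-Algebra, the ambient structure is required to be a groupoid.\<close>

definition normal_subgroupoid :: "'a set \<Rightarrow> ('a, 'b) partial_magma_scheme \<Rightarrow> bool" where
  "normal_subgroupoid H G \<longleftrightarrow>
     groupoid G \<and> wide_subgroupoid H G \<and> (\<forall>g \<in> carrier G. conj_set G g H \<subseteq> H)"

end

theory Submission
  imports Defs
begin

text \<open>Axiom (4) forces \<open>g \<cdot> h\<close> to be defined exactly when the domain of \<open>g\<close> is the range of \<open>h\<close>,
  so the isotropy sets are groups and everything reduces to centers of groups.
  Subgroupoids are closed under domain and range, hence domains, ranges and inverses can be computed
  in the ambient groupoid. Conjugation by an isotropy element fixes central elements, so every wide
  subgroupoid of the center, in particular the center itself, is normal in the isotropy subgroupoid.\<close>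

section \<open>Centers of groups\<close>

lemma (in group) subgroup_group_center: "subgroup (group_center G) G"
proof (rule subgroupI)
  show "group_center G \<subseteq> carrier G"
    by (auto simp: group_center_def)
  show "group_center G \<noteq> {}"
    by (auto simp: group_center_def intro!: exI[of _ \<one>])
next
  fix a assume "a \<in> group_center G"
  then have a: "a \<in> carrier G" and comm: "\<And>x. x \<in> carrier G \<Longrightarrow> a \<otimes> x = x \<otimes> a"
    by (auto simp: group_center_def)
  have "inv a \<otimes> x = x \<otimes> inv a" if x: "x \<in> carrier G" for x
  proof -
    \<comment> \<open>Commuting \<open>a\<close> past \<open>x\<close> lets it cancel against
      \<open>inv a\<close>; solving the resulting equation for \<open>x \<otimes> inv a\<close>
      gives \<open>inv a \<otimes> x\<close>.\<close>
    have "a \<otimes> (x \<otimes> inv a) = x \<otimes> a \<otimes> inv a"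
      using a x by (simp add: comm m_assoc[symmetric])
    also have "\<dots> = x"
      using a x by (simp add: m_assoc)
    finally show ?thesis
      using a x inv_solve_left[of "x \<otimes> inv a" a x] by simp
  qed
  with a show "inv a \<in> group_center G"
    unfolding group_center_def by blast
next
  fix a b assume "a \<in> group_center G" and "b \<in> group_center G"
  then have a: "a \<in> carrier G" "\<And>x. x \<in> carrier G \<Longrightarrow> a \<otimes> x = x \<otimes> a"
    and b: "b \<in> carrier G" "\<And>x. x \<in> carrier G \<Longrightarrow> b \<otimes> x = x \<otimes> b"
    by (auto simp: group_center_def)
  have "a \<otimes> b \<otimes> x = x \<otimes> (a \<otimes> b)" if x: "x \<in> carrier G" for x
  proof -
    have "a \<otimes> b \<otimes> x = a \<otimes> x \<otimes> b"
      using a(1) b(1) x by (simp add: b(2)[OF x] m_assoc)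
    also have "\<dots> = x \<otimes> (a \<otimes> b)"
      using a(1) b(1) x by (simp add: a(2)[OF x] m_assoc)
    finally show ?thesis .
  qed
  with a(1) b(1) show "a \<otimes> b \<in> group_center G"
    unfolding group_center_def by blast
qed

lemma (in group) group_center_eq_carrier_iff: "group_center G = carrier G \<longleftrightarrow> comm_group G"
proof
  assume "group_center G = carrier G"
  then show "comm_group G"
    by (intro group_comm_groupI) (auto simp: group_center_def)
next
  assume "comm_group G"
  then interpret comm_group G .
  show "group_center G = carrier G"
    by (auto simp: group_center_def m_comm)
qed

lemma subgroupoidD:
  assumes "subgroupoid H G"
  shows subgroupoid_subset: "H \<subseteq> carrier G"
    and subgroupoid_nonempty: "H \<noteq> {}"
    and subgroupoid_g_inv_closed: "g \<in> H \<Longrightarrow> g_inv G g \<in> H"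
    and subgroupoid_mult_closed: "\<lbrakk>g \<in> H; h \<in> H; g \<cdot>\<^bsub>G\<^esub> h = Some k\<rbrakk> \<Longrightarrow> k \<in> H"
  using assms unfolding subgroupoid_def by (elim conjE, assumption | blast)+

section \<open>Domains, ranges and the definedness of products\<close>

context groupoid
begin

lemma dom_id: "g \<in> carrier G \<Longrightarrow> dom_id G g \<in> carrier G \<and> g \<cdot> dom_id G g = Some g"
  unfolding dom_id_def by (rule theI') (rule ex1_dom)

lemma ran_id: "g \<in> carrier G \<Longrightarrow> ran_id G g \<in> carrier G \<and> ran_id G g \<cdot> g = Some g"
  unfolding ran_id_def by (rule theI') (rule ex1_ran)

lemma dom_id_closed [simp]: "g \<in> carrier G \<Longrightarrow> dom_id G g \<in> carrier G"
  and mult_dom_id [simp]: "g \<in> carrier G \<Longrightarrow> g \<cdot> dom_id G g = Some g"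
  and ran_id_closed [simp]: "g \<in> carrier G \<Longrightarrow> ran_id G g \<in> carrier G"
  and ran_id_mult [simp]: "g \<in> carrier G \<Longrightarrow> ran_id G g \<cdot> g = Some g"
  using dom_id ran_id by auto

lemma dom_id_eqI: "\<lbrakk>g \<in> carrier G; d \<in> carrier G; g \<cdot> d = Some g\<rbrakk> \<Longrightarrow> dom_id G g = d"
  using ex1_dom dom_id by blast

lemma ran_id_eqI: "\<lbrakk>g \<in> carrier G; r \<in> carrier G; r \<cdot> g = Some g\<rbrakk> \<Longrightarrow> ran_id G g = r"
  using ex1_ran ran_id by blast

lemma assoc_Some:
  assumes "g \<in> carrier G" "h \<in> carrier G" "l \<in> carrier G" "g \<cdot> h = Some a" "h \<cdot> l = Some b"
  shows "g \<cdot> b = a \<cdot> l"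
  using assoc[of g h l] assms by simp

lemma mult_mult_defined:
  assumes "g \<in> carrier G" "h \<in> carrier G" "l \<in> carrier G" "g \<cdot> h = Some a" "h \<cdot> l = Some b"
  shows "g \<cdot> b \<noteq> None"
  using defined_iff[of g h l] assms by simp

text \<open>Propagates definedness before the domain criterion is available: axiom (1) turns one
  bracketing into the other, and the existence of the outer product includes that of the inner
  one.\<close>

lemma mult_mult_SomeE:
  assumes "g \<in> carrier G" "h \<in> carrier G" "l \<in> carrier G" "g \<cdot> h = Some a" "a \<cdot> l = Some c"
  obtains b where "b \<in> carrier G" "h \<cdot> l = Some b" "g \<cdot> b = Some c"
proof -
  have "Option.bind (h \<cdot> l) (\<lambda>x. g \<cdot> x) = Some c"
    using assoc[of g h l] assms by simp
  then obtain b where "h \<cdot> l = Some b" "g \<cdot> b = Some c"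
    by (auto simp: bind_eq_Some_conv)
  with closed[of h l b] assms that show thesis by blast
qed

lemma mult_mult_SomeE':
  assumes "g \<in> carrier G" "h \<in> carrier G" "l \<in> carrier G" "h \<cdot> l = Some b" "g \<cdot> b = Some c"
  obtains a where "a \<in> carrier G" "g \<cdot> h = Some a" "a \<cdot> l = Some c"
proof -
  have "Option.bind (g \<cdot> h) (\<lambda>x. x \<cdot> l) = Some c"
    using assoc[of g h l] assms by simp
  then obtain a where "g \<cdot> h = Some a" "a \<cdot> l = Some c"
    by (auto simp: bind_eq_Some_conv)
  with closed[of g h a] assms that show thesis by blast
qed

text \<open>Reassociating \<open>(g \<cdot> d) \<cdot> d = g\<close> for
  \<open>d = dom_id G g\<close> produces \<open>b = d \<cdot> d\<close> with
  \<open>g \<cdot> b = g\<close>; uniqueness of the domain forces \<open>b = d\<close>.\<close>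

lemma dom_id_idem: "g \<in> carrier G \<Longrightarrow> dom_id G g \<cdot> dom_id G g = Some (dom_id G g)"
  by (rule mult_mult_SomeE[of g "dom_id G g" "dom_id G g" g g]) (use dom_id_eqI in auto)

lemma ran_id_idem: "g \<in> carrier G \<Longrightarrow> ran_id G g \<cdot> ran_id G g = Some (ran_id G g)"
  by (rule mult_mult_SomeE'[of "ran_id G g" "ran_id G g" g g g]) (use ran_id_eqI in auto)

lemma idempotent_id:
  assumes "e \<in> carrier G" "e \<cdot> e = Some e"
  shows "dom_id G e = e" "ran_id G e = e"
  using assms dom_id_eqI ran_id_eqI by auto

lemma dom_ran_id_simps [simp]:
  assumes "g \<in> carrier G"
  shows "dom_id G (dom_id G g) = dom_id G g" "ran_id G (dom_id G g) = dom_id G g"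
    "dom_id G (ran_id G g) = ran_id G g" "ran_id G (ran_id G g) = ran_id G g"
  using assms idempotent_id dom_id_idem ran_id_idem by simp_all

text \<open>With \<open>y'\<close> inverse to \<open>y = e \<cdot> f\<close>, cancellation gives \<open>y' \<cdot> e = f\<close> and \<open>f \<cdot> y' = e\<close>;
  then \<open>f \<cdot> y' \<cdot> e\<close> equals both \<open>f\<close> and \<open>e\<close>.\<close>

lemma idempotents_mult_defined_eq:
  assumes e: "e \<in> carrier G" "e \<cdot> e = Some e" and f: "f \<in> carrier G" "f \<cdot> f = Some f"
    and ef: "e \<cdot> f = Some y"
  shows "e = f"
proof -
  have y: "y \<in> carrier G" using closed e f ef by blast
  have "e \<cdot> y = Some y" using assoc_Some[of e e f e y] e f ef by simp
  then have ry: "ran_id G y = e" using ran_id_eqI e y by blast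
  have "y \<cdot> f = Some y" using assoc_Some[of e f f y f] e f ef by simp
  then have dy: "dom_id G y = f" using dom_id_eqI f y by blast
  obtain y' where y': "y' \<in> carrier G" "y' \<cdot> y = Some f" "y \<cdot> y' = Some e"
    using ex_inv[OF y] ry dy by auto
  obtain a where a: "a \<in> carrier G" "y' \<cdot> e = Some a" "a \<cdot> f = Some f"
    using mult_mult_SomeE'[OF y'(1) e(1) f(1) ef y'(2)] by blast
  then have "a = f" using ran_id_eqI idempotent_id f by metis
  moreover obtain b where b: "b \<in> carrier G" "f \<cdot> y' = Some b" "e \<cdot> b = Some e"
    using mult_mult_SomeE[OF e(1) f(1) y'(1) ef y'(3)] by blast
  moreover from b have "b = e" using dom_id_eqI idempotent_id e by metis
  ultimately have "f \<cdot> f = e \<cdot> e"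
    using assoc_Some[of f y' e e f] a f e y' by simp
  with e f show ?thesis by simp
qed

text \<open>If \<open>g \<cdot> h\<close> exists, writing \<open>h\<close> as
  \<open>ran_id G h \<cdot> h\<close> and then \<open>g\<close> as
  \<open>g \<cdot> dom_id G g\<close> shows that the idempotents \<open>dom_id G g\<close> and
  \<open>ran_id G h\<close> have a defined product, so they coincide. Conversely,
  \<open>g \<cdot> dom_id G g\<close> and \<open>dom_id G g \<cdot> h = h\<close> exist, and axiom
  (2) joins them.\<close>

lemma mult_defined_iff:
  assumes g: "g \<in> carrier G" and h: "h \<in> carrier G"
  shows "(\<exists>k. g \<cdot> h = Some k) \<longleftrightarrow> dom_id G g = ran_id G h"
proof
  assume "\<exists>k. g \<cdot> h = Some k"
  then obtain k where k: "g \<cdot> h = Some k" by blast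
  obtain x where x: "x \<in> carrier G" "g \<cdot> ran_id G h = Some x"
    using mult_mult_SomeE'[of g "ran_id G h" h h k] g h k by auto
  then obtain y where "dom_id G g \<cdot> ran_id G h = Some y"
    using mult_mult_SomeE[of g "dom_id G g" "ran_id G h" g x] g h by auto
  then show "dom_id G g = ran_id G h"
    using idempotents_mult_defined_eq g h dom_id_idem ran_id_idem by simp
next
  assume "dom_id G g = ran_id G h"
  then have "dom_id G g \<cdot> h = Some h" using h by simp
  then have "g \<cdot> h \<noteq> None"
    using mult_mult_defined g h dom_id by blast
  then show "\<exists>k. g \<cdot> h = Some k" by blast
qed

lemma mult_SomeD:
  assumes g: "g \<in> carrier G" and h: "h \<in> carrier G" and k: "g \<cdot> h = Some k"
  shows "k \<in> carrier G" "dom_id G g = ran_id G h" "dom_id G k = dom_id G h" "ran_id G k = ran_id G g"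
proof -
  show kc: "k \<in> carrier G" using closed g h k by blast
  show "dom_id G g = ran_id G h" using mult_defined_iff g h k by blast
  show "dom_id G k = dom_id G h"
    using assoc_Some[of g h "dom_id G h" k h] g h k kc by (intro dom_id_eqI) auto
  show "ran_id G k = ran_id G g"
    using assoc_Some[of "ran_id G g" g h g k] g h k kc by (intro ran_id_eqI) auto
qed

section \<open>Identities and inverses\<close>

lemma identities_iff: "e \<in> identities G \<longleftrightarrow> e \<in> carrier G \<and> e \<cdot> e = Some e"
proof
  assume e: "e \<in> identities G"
  then have "e \<in> carrier G" by (simp add: identities_def)
  \<comment> \<open>The same product equals \<open>e\<close> by the defining property of the domain,
    so \<open>e\<close> is its own domain and hence idempotent.\<close>
  moreover from this e have "e \<cdot> dom_id G e = Some (dom_id G e)"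
    by (simp add: identities_def)
  ultimately show "e \<in> carrier G \<and> e \<cdot> e = Some e"
    by (metis mult_dom_id option.sel)
next
  assume e: "e \<in> carrier G \<and> e \<cdot> e = Some e"
  then have "dom_id G e = e" "ran_id G e = e" by (auto intro: idempotent_id)
  \<comment> \<open>Definedness forces \<open>ran_id G g = dom_id G e = e\<close>, and the range of
    \<open>g\<close> is a left unit for it.\<close>
  then have "e \<cdot> g = Some g" if "g \<in> carrier G" "e \<cdot> g \<noteq> None" for g
    using e that mult_SomeD(2)[of e g] ran_id_mult[of g] by auto
  moreover have "g \<cdot> e = Some g" if "g \<in> carrier G" "g \<cdot> e \<noteq> None" for g
    using e that mult_SomeD(2)[of g e] mult_dom_id[of g] \<open>ran_id G e = e\<close> by auto
  ultimately show "e \<in> identities G"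
    using e by (simp add: identities_def)
qed

lemma dom_id_in_identities: "g \<in> carrier G \<Longrightarrow> dom_id G g \<in> identities G"
  by (simp add: identities_iff dom_id_idem)

text \<open>The description defining \<open>g_inv\<close> asks for both equations, but a left
  inverse agrees with every right inverse, in particular with the two-sided one from axiom
  (4).\<close>

lemma g_inv_eqI:
  assumes g: "g \<in> carrier G" and x: "x \<in> carrier G" "x \<cdot> g = Some (dom_id G g)"
  shows "g_inv G g = x"
proof -
  have left_right: "u = v"
    if "u \<in> carrier G" "u \<cdot> g = Some (dom_id G g)" "v \<in> carrier G" "g \<cdot> v = Some (ran_id G g)" for u v
  proof -
    have "u \<cdot> ran_id G g = dom_id G g \<cdot> v"
      using assoc_Some[of u g v] g that by simp
    \<comment> \<open>Definedness of \<open>u \<cdot> g\<close> and \<open>g \<cdot> v\<close>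
      identifies the unit factors as the domain of \<open>u\<close> and the range of
      \<open>v\<close>, so the two sides reduce to \<open>u\<close> and \<open>v\<close>.\<close>
    moreover have "dom_id G u = ran_id G g" "dom_id G g = ran_id G v"
      using mult_SomeD(2) g that by blast+
    ultimately show ?thesis
      using mult_dom_id[of u] ran_id_mult[of v] that by simp
  qed
  obtain g' where g': "g' \<in> carrier G" "g' \<cdot> g = Some (dom_id G g)" "g \<cdot> g' = Some (ran_id G g)"
    using ex_inv g by blast
  then have "x = g'" using left_right x by blast
  with g' show ?thesis
    unfolding g_inv_def by (intro the_equality) (use left_right in blast)+
qed

lemma g_inv:
  assumes "g \<in> carrier G"
  shows g_inv_closed [simp]: "g_inv G g \<in> carrier G"
    and g_inv_mult [simp]: "g_inv G g \<cdot> g = Some (dom_id G g)"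
    and mult_g_inv [simp]: "g \<cdot> g_inv G g = Some (ran_id G g)"
    and dom_id_g_inv [simp]: "dom_id G (g_inv G g) = ran_id G g"
    and ran_id_g_inv [simp]: "ran_id G (g_inv G g) = dom_id G g"
proof -
  obtain g' where "g' \<in> carrier G" "g' \<cdot> g = Some (dom_id G g)" "g \<cdot> g' = Some (ran_id G g)"
    using ex_inv assms by blast
  moreover from this have "g_inv G g = g'" using g_inv_eqI assms by blast
  ultimately show *: "g_inv G g \<in> carrier G" "g_inv G g \<cdot> g = Some (dom_id G g)"
    "g \<cdot> g_inv G g = Some (ran_id G g)" by auto
  show "dom_id G (g_inv G g) = ran_id G g" "ran_id G (g_inv G g) = dom_id G g"
    using mult_SomeD(2) assms * by metis+
qed

section \<open>Isotropy groups\<close>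

lemma isotropy_mult:
  assumes "g \<in> isotropy G e" "h \<in> isotropy G e"
  obtains k where "k \<in> isotropy G e" "g \<cdot> h = Some k"
proof -
  from assms have "g \<in> carrier G" "h \<in> carrier G" "dom_id G g = ran_id G h"
    by (auto simp: isotropy_def)
  then obtain k where "g \<cdot> h = Some k" using mult_defined_iff by blast
  with mult_SomeD[of g h k] assms that show thesis by (auto simp: isotropy_def)
qed

lemma g_inv_isotropy: "g \<in> isotropy G e \<Longrightarrow> g_inv G g \<in> isotropy G e"
  by (simp add: isotropy_def)

lemma identity_isotropy: "e \<in> identities G \<Longrightarrow> e \<in> isotropy G e"
  by (auto simp: isotropy_def identities_iff idempotent_id)

text \<open>The base point of an isotropy element can only be its domain, which is always an
  identity; this removes the union from later arguments.\<close>

lemma Iso_iff: "g \<in> Iso G \<longleftrightarrow> g \<in> carrier G \<and> dom_id G g = ran_id G g"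
  unfolding Iso_def isotropy_def using dom_id_in_identities by auto

lemma group_isotropy_group:
  assumes e: "e \<in> identities G"
  shows "group (isotropy_group G e)"
proof (rule groupI)
  fix x y assume "x \<in> carrier (isotropy_group G e)" "y \<in> carrier (isotropy_group G e)"
  then show "x \<otimes>\<^bsub>isotropy_group G e\<^esub> y \<in> carrier (isotropy_group G e)"
    by (auto simp: isotropy_group_def elim: isotropy_mult)
next
  show "\<one>\<^bsub>isotropy_group G e\<^esub> \<in> carrier (isotropy_group G e)"
    using e by (simp add: isotropy_group_def identity_isotropy)
next
  fix x y z
  assume "x \<in> carrier (isotropy_group G e)" "y \<in> carrier (isotropy_group G e)"
    "z \<in> carrier (isotropy_group G e)"
  then have xyz: "x \<in> isotropy G e" "y \<in> isotropy G e" "z \<in> isotropy G e"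
    by (simp_all add: isotropy_group_def)
  obtain a b where "x \<cdot> y = Some a" "y \<cdot> z = Some b"
    using isotropy_mult xyz by metis
  with xyz assoc_Some[of x y z a b]
  show "x \<otimes>\<^bsub>isotropy_group G e\<^esub> y \<otimes>\<^bsub>isotropy_group G e\<^esub> z =
        x \<otimes>\<^bsub>isotropy_group G e\<^esub> (y \<otimes>\<^bsub>isotropy_group G e\<^esub> z)"
    by (simp add: isotropy_group_def isotropy_def)
next
  fix x assume "x \<in> carrier (isotropy_group G e)"
  then have x: "x \<in> isotropy G e" by (simp add: isotropy_group_def)
  then have "e \<cdot> x = Some x"
    using ran_id_mult[of x] by (auto simp: isotropy_def)
  then show "\<one>\<^bsub>isotropy_group G e\<^esub> \<otimes>\<^bsub>isotropy_group G e\<^esub> x = x"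
    by (simp add: isotropy_group_def)
  have "g_inv G x \<cdot> x = Some e" using x by (simp add: isotropy_def)
  with g_inv_isotropy[OF x]
  show "\<exists>y\<in>carrier (isotropy_group G e).
      y \<otimes>\<^bsub>isotropy_group G e\<^esub> x = \<one>\<^bsub>isotropy_group G e\<^esub>"
    by (force simp: isotropy_group_def)
qed

text \<open>Transfers closure under inverses from the group centers to the center of the
  groupoid.\<close>

lemma inv_isotropy_group:
  assumes e: "e \<in> identities G" and x: "x \<in> isotropy G e"
  shows "inv\<^bsub>isotropy_group G e\<^esub> x = g_inv G x"
proof (rule group.inv_equality[OF group_isotropy_group[OF e]])
  show "g_inv G x \<otimes>\<^bsub>isotropy_group G e\<^esub> x = \<one>\<^bsub>isotropy_group G e\<^esub>"
    using x by (simp add: isotropy_group_def isotropy_def)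
qed (use x g_inv_isotropy in \<open>simp_all add: isotropy_group_def\<close>)

section \<open>The center as a disjoint union of group centers\<close>

lemma group_center_isotropy_group_iff:
  "z \<in> group_center (isotropy_group G e) \<longleftrightarrow>
     z \<in> isotropy G e \<and> (\<forall>x \<in> isotropy G e. z \<cdot> x = x \<cdot> z)"
  \<comment> \<open>Products inside one isotropy set are always \<open>Some\<close>, so equality
    under \<open>the\<close> is equality of options.\<close>
  by (auto simp: group_center_def isotropy_group_def)
    (metis isotropy_mult option.sel)

text \<open>For \<open>z\<close> based at \<open>e\<close>, the side condition in
  \<open>groupoid_center\<close> says exactly that \<open>h\<close> lies in
  \<open>isotropy G e\<close>, so both centers test commutation with the same elements.\<close>

lemma groupoid_center_iff:
  assumes "e \<in> identities G" "z \<in> isotropy G e"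
  shows "z \<in> groupoid_center G \<longleftrightarrow> z \<in> group_center (isotropy_group G e)"
  unfolding group_center_isotropy_group_iff groupoid_center_def Iso_def
  using assms by (auto simp: isotropy_def)

lemma groupoid_center_comm:
  "\<lbrakk>z \<in> groupoid_center G; x \<in> carrier G; dom_id G z = ran_id G x; ran_id G x = dom_id G x\<rbrakk>
    \<Longrightarrow> z \<cdot> x = x \<cdot> z"
  unfolding groupoid_center_def by blast

lemma groupoid_center_eq:
  "groupoid_center G = (\<Union>e \<in> identities G. group_center (isotropy_group G e))"
proof (intro equalityI subsetI)
  fix z assume z: "z \<in> groupoid_center G"
  then obtain e where "e \<in> identities G" "z \<in> isotropy G e"
    by (auto simp: groupoid_center_def Iso_def)
  with z show "z \<in> (\<Union>e \<in> identities G. group_center (isotropy_group G e))"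
    using groupoid_center_iff by blast
next
  fix z assume "z \<in> (\<Union>e \<in> identities G. group_center (isotropy_group G e))"
  then show "z \<in> groupoid_center G"
    using groupoid_center_iff group_center_isotropy_group_iff by blast
qed

text \<open>The index is recovered from an element as its domain.\<close>

lemma disjoint_family_group_center:
  "disjoint_family_on (\<lambda>e. group_center (isotropy_group G e)) A"
  by (auto simp: disjoint_family_on_def group_center_def isotropy_group_def isotropy_def)

lemma groupoid_center_subset_Iso: "groupoid_center G \<subseteq> Iso G"
  by (auto simp: groupoid_center_def)

text \<open>The equality splits over the identities: the isotropy set at \<open>e\<close> is central
  iff the isotropy group is its own center, that is, commutative.\<close>

lemma groupoid_center_eq_Iso_iff: "groupoid_center G = Iso G \<longleftrightarrow> abelian_groupoid G"
proof -
  have "groupoid_center G = Iso G \<longleftrightarrow>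
      (\<forall>e \<in> identities G. \<forall>z \<in> isotropy G e. z \<in> groupoid_center G)"
    using groupoid_center_subset_Iso by (auto simp: Iso_def)
  also have "\<dots> \<longleftrightarrow>
      (\<forall>e \<in> identities G. group_center (isotropy_group G e) = carrier (isotropy_group G e))"
  proof -
    have "(\<forall>z \<in> isotropy G e. z \<in> groupoid_center G) \<longleftrightarrow>
        group_center (isotropy_group G e) = carrier (isotropy_group G e)"
      if "e \<in> identities G" for e
      using groupoid_center_iff[OF that] group_center_isotropy_group_iff
      by (auto simp: isotropy_group_def)
    then show ?thesis by blast
  qed
  also have "\<dots> \<longleftrightarrow> abelian_groupoid G"
    using group.group_center_eq_carrier_iff[OF group_isotropy_group] groupoid_axioms
    by (simp add: abelian_groupoid_def)
  finally show ?thesis .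
qed

section \<open>Subgroupoids as restricted structures\<close>

lemma subgroupoid_dom_ran_closed:
  assumes H: "subgroupoid H G" and g: "g \<in> H"
  shows "dom_id G g \<in> H" "ran_id G g \<in> H"
proof -
  have "g \<in> carrier G" "g_inv G g \<in> H"
    using subgroupoid_subset[OF H] subgroupoid_g_inv_closed[OF H] g by auto
  then show "dom_id G g \<in> H" "ran_id G g \<in> H"
    \<comment> \<open>Domain and range are the products of \<open>g\<close> with its inverse, in the
      two orders.\<close>
    using subgroupoid_mult_closed[OF H] g g_inv_mult[of g] mult_g_inv[of g] by metis+
qed

text \<open>The description now ranges over \<open>H\<close>, which still contains the ambient
  domain; uniqueness in \<open>G\<close> rules out any other candidate.\<close>

lemma dom_id_restrict:
  assumes "subgroupoid H G" "g \<in> H"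
  shows "dom_id (restrict_to G H) g = dom_id G g"
  unfolding dom_id_def[of "restrict_to G H"]
proof (rule the_equality)
  have H: "H \<subseteq> carrier G" using assms(1) by (rule subgroupoid_subset)
  with assms(2) have g: "g \<in> carrier G" by blast
  with subgroupoid_dom_ran_closed[OF assms]
  show "dom_id G g \<in> carrier (restrict_to G H) \<and> g \<cdot>\<^bsub>restrict_to G H\<^esub> dom_id G g = Some g"
    by simp
  fix x assume "x \<in> carrier (restrict_to G H) \<and> g \<cdot>\<^bsub>restrict_to G H\<^esub> x = Some g"
  then have "x \<in> carrier G" "g \<cdot> x = Some g" using H by auto
  with g show "x = dom_id G g" using dom_id_eqI by blast
qed

lemma ran_id_restrict:
  assumes "subgroupoid H G" "g \<in> H"
  shows "ran_id (restrict_to G H) g = ran_id G g"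
  unfolding ran_id_def[of "restrict_to G H"]
proof (rule the_equality)
  have H: "H \<subseteq> carrier G" using assms(1) by (rule subgroupoid_subset)
  with assms(2) have g: "g \<in> carrier G" by blast
  with subgroupoid_dom_ran_closed[OF assms]
  show "ran_id G g \<in> carrier (restrict_to G H) \<and> ran_id G g \<cdot>\<^bsub>restrict_to G H\<^esub> g = Some g"
    by simp
  fix x assume "x \<in> carrier (restrict_to G H) \<and> x \<cdot>\<^bsub>restrict_to G H\<^esub> g = Some g"
  then have "x \<in> carrier G" "x \<cdot> g = Some g" using H by auto
  with g show "x = ran_id G g" using ran_id_eqI by blast
qed

text \<open>The associativity and definedness axioms are inherited by quantifying over fewer
  elements; the existence axioms use that \<open>H\<close> contains the domains, ranges and inverses
  of its members.\<close>

lemma groupoid_restrict: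
  assumes H: "subgroupoid H G"
  shows "groupoid (restrict_to G H)"
proof
  have HG: "x \<in> carrier G" if "x \<in> H" for x
    using subgroupoid_subset[OF H] that by blast
  fix g h l
  show "k \<in> carrier (restrict_to G H)"
    if "g \<in> carrier (restrict_to G H)" "h \<in> carrier (restrict_to G H)"
      "g \<cdot>\<^bsub>restrict_to G H\<^esub> h = Some k" for k
    using subgroupoid_mult_closed[OF H, of g h k] that by simp
  assume "g \<in> carrier (restrict_to G H)"
  then have g: "g \<in> H" "g \<in> carrier G" using HG by auto
  have dr: "dom_id G g \<in> H" "ran_id G g \<in> H"
    using subgroupoid_dom_ran_closed H g by blast+
  show "\<exists>!d. d \<in> carrier (restrict_to G H) \<and> g \<cdot>\<^bsub>restrict_to G H\<^esub> d = Some g"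
    using g dr by simp (metis HG dom_id_eqI mult_dom_id)
  show "\<exists>!r. r \<in> carrier (restrict_to G H) \<and> r \<cdot>\<^bsub>restrict_to G H\<^esub> g = Some g"
    using g dr by simp (metis HG ran_id_eqI ran_id_mult)
  show "\<exists>g' \<in> carrier (restrict_to G H).
      g' \<cdot>\<^bsub>restrict_to G H\<^esub> g = Some (dom_id (restrict_to G H) g) \<and>
      g \<cdot>\<^bsub>restrict_to G H\<^esub> g' = Some (ran_id (restrict_to G H) g)"
    using g H by (intro bexI[of _ "g_inv G g"])
      (simp_all add: dom_id_restrict ran_id_restrict subgroupoid_g_inv_closed)
  assume "h \<in> carrier (restrict_to G H)" "l \<in> carrier (restrict_to G H)"
  then have hl: "h \<in> carrier G" "l \<in> carrier G" using HG by auto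
  show "Option.bind (h \<cdot>\<^bsub>restrict_to G H\<^esub> l) (\<lambda>x. g \<cdot>\<^bsub>restrict_to G H\<^esub> x) =
      Option.bind (g \<cdot>\<^bsub>restrict_to G H\<^esub> h) (\<lambda>x. x \<cdot>\<^bsub>restrict_to G H\<^esub> l)"
    using assoc[OF g(2) hl] by simp
  show "Option.bind (h \<cdot>\<^bsub>restrict_to G H\<^esub> l) (\<lambda>x. g \<cdot>\<^bsub>restrict_to G H\<^esub> x) \<noteq> None \<longleftrightarrow>
      g \<cdot>\<^bsub>restrict_to G H\<^esub> h \<noteq> None \<and> h \<cdot>\<^bsub>restrict_to G H\<^esub> l \<noteq> None"
    using defined_iff[OF g(2) hl] by simp
qed

lemma g_inv_restrict:
  assumes "subgroupoid H G" "g \<in> H"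
  shows "g_inv (restrict_to G H) g = g_inv G g"
proof (rule groupoid.g_inv_eqI[OF groupoid_restrict[OF assms(1)]])
  show "g_inv G g \<cdot>\<^bsub>restrict_to G H\<^esub> g = Some (dom_id (restrict_to G H) g)"
    using assms subgroupoid_subset[OF assms(1)] by (simp add: dom_id_restrict subset_iff)
qed (use assms subgroupoid_g_inv_closed in simp_all)

text \<open>Being a unit is tested against the carrier, so a smaller carrier might admit more
  identities; the equivalent condition of idempotence does not look at other elements.\<close>

lemma identities_restrict:
  assumes "subgroupoid H G"
  shows "identities (restrict_to G H) = identities G \<inter> H"
  using subgroupoid_subset[OF assms] groupoid.identities_iff[OF groupoid_restrict[OF assms]]
  by (auto simp: identities_iff)

text \<open>Nested restrictions can be handled in \<open>G\<close> alone, because multiplication is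
  unchanged and inverses of elements of \<open>K\<close> agree with the ambient ones.\<close>

lemma subgroupoid_restrict_iff:
  assumes "subgroupoid K G"
  shows "subgroupoid H (restrict_to G K) \<longleftrightarrow> subgroupoid H G \<and> H \<subseteq> K"
proof -
  have "(\<forall>g \<in> H. g_inv (restrict_to G K) g \<in> H) \<longleftrightarrow> (\<forall>g \<in> H. g_inv G g \<in> H)" if "H \<subseteq> K"
    using that g_inv_restrict[OF assms] by (simp add: subset_iff)
  moreover have "H \<subseteq> carrier G" if "H \<subseteq> K"
    using that subgroupoid_subset[OF assms] by (rule subset_trans)
  ultimately show ?thesis
    unfolding subgroupoid_def[of H] by (simp cong: conj_cong) blast
qed

lemma wide_subgroupoid_restrict_iff:
  assumes K: "subgroupoid K G" and wide: "identities G \<subseteq> K"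
  shows "wide_subgroupoid H (restrict_to G K) \<longleftrightarrow>
    subgroupoid H G \<and> H \<subseteq> K \<and> identities G \<subseteq> H"
  using identities_restrict[OF K] identities_restrict[of H] wide
  by (auto simp: wide_subgroupoid_def subgroupoid_restrict_iff[OF K])

section \<open>The isotropy subgroupoid and the center as subgroupoids\<close>

lemma identities_subset_Iso: "identities G \<subseteq> Iso G"
  using identity_isotropy by (auto simp: Iso_def)

lemma subgroupoid_Iso:
  assumes "carrier G \<noteq> {}"
  shows "subgroupoid (Iso G) G"
  unfolding subgroupoid_def
proof (intro conjI ballI allI impI)
  show "Iso G \<noteq> {}"
    using assms dom_id_in_identities identities_subset_Iso by blast
  fix g h k assume "g \<in> Iso G" "h \<in> Iso G" "g \<cdot> h = Some k"
  then show "k \<in> Iso G"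
    using mult_SomeD[of g h k] by (simp add: Iso_iff)
qed (auto simp: Iso_iff)

lemma identities_subset_groupoid_center: "identities G \<subseteq> groupoid_center G"
proof
  fix e assume e: "e \<in> identities G"
  \<comment> \<open>\<open>e\<close> is the unit of its own isotropy group, and the center of that
    group is a subgroup.\<close>
  then have "\<one>\<^bsub>isotropy_group G e\<^esub> \<in> group_center (isotropy_group G e)"
    using group.subgroup_group_center group_isotropy_group subgroup.one_closed by blast
  with e show "e \<in> groupoid_center G"
    by (auto simp: groupoid_center_eq isotropy_group_def)
qed

lemma subgroupoid_groupoid_center:
  assumes "carrier G \<noteq> {}"
  shows "subgroupoid (groupoid_center G) G"
  unfolding subgroupoid_def
proof (intro conjI ballI allI impI)
  show "groupoid_center G \<subseteq> carrier G"
    using groupoid_center_subset_Iso by (auto simp: Iso_iff)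
  show "groupoid_center G \<noteq> {}"
    using assms dom_id_in_identities identities_subset_groupoid_center by blast
next
  fix g assume "g \<in> groupoid_center G"
  then obtain e where e: "e \<in> identities G" and g: "g \<in> group_center (isotropy_group G e)"
    by (auto simp: groupoid_center_eq)
  then have "inv\<^bsub>isotropy_group G e\<^esub> g \<in> group_center (isotropy_group G e)"
    using group.subgroup_group_center[OF group_isotropy_group] subgroup.m_inv_closed by metis
  with e g show "g_inv G g \<in> groupoid_center G"
    by (auto simp: groupoid_center_eq inv_isotropy_group group_center_isotropy_group_iff)
next
  fix g h k assume gh: "g \<in> groupoid_center G" "h \<in> groupoid_center G" and k: "g \<cdot> h = Some k"
  from gh obtain e f where e: "e \<in> identities G" and g: "g \<in> group_center (isotropy_group G e)"
    and h: "h \<in> group_center (isotropy_group G f)"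
    by (auto simp: groupoid_center_eq)
  then have "dom_id G g = e" "ran_id G h = f" "g \<in> carrier G" "h \<in> carrier G"
    by (simp_all add: group_center_isotropy_group_iff isotropy_def)
  \<comment> \<open>A defined product forces both factors to have the same base point, so closure
    reduces to that of a single group center.\<close>
  with k have "f = e" using mult_SomeD(2) by metis
  with e g h have "g \<otimes>\<^bsub>isotropy_group G e\<^esub> h \<in> group_center (isotropy_group G e)"
    using group.subgroup_group_center[OF group_isotropy_group] subgroup.m_closed by metis
  with e k show "k \<in> groupoid_center G"
    by (auto simp: groupoid_center_eq isotropy_group_def)
qed

section \<open>Conjugation and normality in the isotropy subgroupoid\<close>

lemma conj_groupoid_center:
  assumes h: "h \<in> groupoid_center G" and g: "g \<in> Iso G" and hg: "dom_id G h = ran_id G g"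
  shows "Option.bind (g_inv G g \<cdot> h) (\<lambda>y. y \<cdot> g) = Some h"
proof -
  have hc: "h \<in> carrier G" and gc: "g \<in> carrier G" and dg: "dom_id G g = ran_id G g"
    using subsetD[OF groupoid_center_subset_Iso h] g by (simp_all add: Iso_iff)
  \<comment> \<open>The inverse of an isotropy element is based at the same identity, so the
    centrality of \<open>h\<close> applies to it; afterwards \<open>g_inv G g\<close> cancels
    against \<open>g\<close>.\<close>
  have "h \<cdot> g_inv G g = g_inv G g \<cdot> h"
    using gc dg hg by (intro groupoid_center_comm[OF h]) simp_all
  then have "Option.bind (g_inv G g \<cdot> h) (\<lambda>y. y \<cdot> g) = h \<cdot> dom_id G g"
    using assoc[of h "g_inv G g" g] hc gc by simp
  with hc dg hg mult_dom_id[of h] show ?thesis by simp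
qed

text \<open>Covers the center itself and its wide subgroupoids at once: conjugating
  \<open>h \<in> H\<close> by an isotropy element returns \<open>h\<close>.\<close>

lemma normal_subgroupoid_Iso:
  assumes H: "subgroupoid H G" and HZ: "H \<subseteq> groupoid_center G" and wide: "identities G \<subseteq> H"
  shows "normal_subgroupoid H (restrict_to G (Iso G))"
proof -
  have "carrier G \<noteq> {}" using subgroupoid_subset[OF H] subgroupoid_nonempty[OF H] by blast
  then have I: "subgroupoid (Iso G) G" by (rule subgroupoid_Iso)
  have HI: "H \<subseteq> Iso G" using HZ groupoid_center_subset_Iso by blast
  have "conj_set (restrict_to G (Iso G)) g H \<subseteq> H" if g: "g \<in> Iso G" for g
  proof
    fix x assume "x \<in> conj_set (restrict_to G (Iso G)) g H"
    then obtain h where h: "h \<in> H" "dom_id (restrict_to G (Iso G)) h = ran_id (restrict_to G (Iso G)) g"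
      "Option.bind (g_inv (restrict_to G (Iso G)) g \<cdot> h) (\<lambda>y. y \<cdot> g) = Some x"
      by (auto simp: conj_set_def)
    then have "h \<in> Iso G" using HI by blast
    \<comment> \<open>Domain, range and inverse taken in the restriction to \<open>Iso G\<close> are
      traded for the ambient ones, where conjugation was computed.\<close>
    with h g have "dom_id G h = ran_id G g" "Option.bind (g_inv G g \<cdot> h) (\<lambda>y. y \<cdot> g) = Some x"
      by (simp_all add: dom_id_restrict[OF I] ran_id_restrict[OF I] g_inv_restrict[OF I])
    with h(1) HZ g conj_groupoid_center[of h g] show "x \<in> H" by auto
  qed
  with groupoid_restrict[OF I] H HI wide show ?thesis
    by (simp add: normal_subgroupoid_def wide_subgroupoid_restrict_iff[OF I identities_subset_Iso])
qed

end

theorem proposition4p2: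
  fixes G :: "('a, 'b) partial_magma_scheme"
  assumes "groupoid G" and "carrier G \<noteq> {}"
  shows "(groupoid_center G = (\<Union>e \<in> identities G. group_center (isotropy_group G e)) \<and>
          disjoint_family_on (\<lambda>e. group_center (isotropy_group G e)) (identities G)) \<and>
         (groupoid_center G = Iso G \<longleftrightarrow> abelian_groupoid G) \<and>
         normal_subgroupoid (groupoid_center G) (restrict_to G (Iso G)) \<and>
         (\<forall>H. wide_subgroupoid H (restrict_to G (groupoid_center G)) \<longrightarrow>
              normal_subgroupoid H (restrict_to G (Iso G)))"
proof -
  interpret groupoid G by fact
  have Z: "subgroupoid (groupoid_center G) G"
    using assms(2) by (rule subgroupoid_groupoid_center)
  \<comment> \<open>Expresses wideness in the center through \<open>G\<close> itself, in the form of
    the hypotheses of \<open>normal_subgroupoid_Iso\<close>.\<close>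
  note iff = wide_subgroupoid_restrict_iff[OF Z identities_subset_groupoid_center]
  show ?thesis
  proof (intro conjI allI impI)
    show "normal_subgroupoid (groupoid_center G) (restrict_to G (Iso G))"
      using Z subset_refl identities_subset_groupoid_center by (rule normal_subgroupoid_Iso)
    fix H assume "wide_subgroupoid H (restrict_to G (groupoid_center G))"
    then show "normal_subgroupoid H (restrict_to G (Iso G))"
      by (simp add: iff normal_subgroupoid_Iso)
  qed (rule groupoid_center_eq disjoint_family_group_center groupoid_center_eq_Iso_iff)+
qed

end
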